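(* Let $\mathcal{M}=(S,A,T,\Sigma,L)$ be an MDP, let $\mathcal{A}=\langle\Sigma,Q,q_0,\Delta,\Gamma\rangle$ be a good-for-MDPs (transition-based) B\"uchi automaton, and let $\zeta\in\,]0,1[$. Then for every strategy $f$ and every state $(s,q)$ of $\mathcal{M}\times\mathcal{A}$, the expected $\zeta$-biased reward in $\mathcal{M}\times\mathcal{A}$ equals the expected total reward in $\overline{\mathcal{M}}^\zeta$: $$\mathrm{EDisct}^{\mathcal{M}\times\mathcal{A}}_\zeta((s,q),f)=\mathrm{ETotal}^{\overline{\mathcal{M}}^\zeta}((s,q),f).$$
   Context: A (transition-based) B\"uchi automaton $\mathcal{A}=\langle\Sigma,Q,q_0,\Delta,\Gamma\rangle$ has finite alphabet $\Sigma$, finite state set $Q$, initial state $q_0$, transitions $\Delta\subseteq Q\times\Sigma\times Q$ and accepting transitions $\Gamma\subseteq Q\times\Sigma\times Q$; a run is accepting if some transition of $\Gamma$ occurs infinitely often, and $L_{\mathcal{A}}$ is the set of accepted words. An MDP $\mathcal{M}=(S,A,T,\Sigma,L)$ has finite states $S$, finite actions $A$, transition function $T:S\times A\to\mathrm{Dist}(S)$ and transition labelling $L:S\times A\times S\to\Sigma$. A strategy maps finite runs to distributions over the actions available at the last state. The product $\mathcal{M}\times\mathcal{A}$ is the MDP with states $S\times Q$, actions $A\times Q$, and $T^\times((s,q),(a,q'))((s',q'))=T(s,a)(s')$ if $(q,L(s,a,s'),q')\in\Delta$ and $0$ otherwise; its accepting transitions are the triples $((s,q),(a,q'),(s',q'))$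 with $(q,L(s,a,s'),q')\in\Gamma$ and $T(s,a)(s')>0$. $\mathcal{A}$ is good for MDPs if for every MDP the supremum over strategies of the probability that the product run takes accepting transitions infinitely often equals the supremum over strategies of the probability that the run's label lies in $L_{\mathcal{A}}$. For a run $r$ of $\mathcal{M}\times\mathcal{A}$ containing $n\in\mathbb{N}_0\cup\{\infty\}$ accepting transitions, the $\zeta$-biased reward is $\mathrm{Disct}_\zeta(r)=\sum_{i=0}^{n-1}\zeta^i$ (i.e. the $(i+1)$-st accepting transition earns reward $\zeta^i$), and $\mathrm{EDisct}^{\mathcal{M}\times\mathcal{A}}_\zeta((s,q),f)$ is its expectation over runs from $(s,q)$ under $f$. $\overline{\mathcal{M}}^\zeta$ is obtained from $\mathcal{M}\times\mathcal{A}$ by adding a new sink state $t$ at which the computation stops and modifying every accepting transition: whenever an accepting transition to $(s',q')$ (of original probability $p$) is taken, with probability $p(1-\zeta)$ the run goes to $t$ instead and with probability $p\zeta$ it goes to $(s',q')$; it has the same strategies as $\mathcal{M}\times\mathcal{A}$. Each time an accepting transition is taken (whether it leads to $t$ or not) a reward $1$ is earned; for a run $r$ with $n\in\mathbb{N}_0\cup\{\infty\}$ accepting transitions, $\mathrm{Total}(r)=n$, and $\mathrm{ETotal}^{\overline{\mathcal{M}}^\zeta}((s,q),f)$ is the expectation of $\mathrm{Total}$ over runs of $\overline{\mathcal{M}}^\zeta$ from $(s,q)$ under $f$. *)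

theory Defs
  imports "HOL-Probability.Probability"
begin

section \<open>Decision processes, strategies and the probability space of runs\<close>

text \<open>
  The rows of \<open>ptrans\<close> are sub-probability distributions: with the missing mass (the value
  \<open>None\<close> of the underlying pmf) the computation stops.
\<close>

record ('s, 'a) proc =
  pstates :: "'s set"
  pactions :: "'a set"
  ptrans :: "'s \<Rightarrow> 'a \<Rightarrow> 's spmf"

definition proc_wf :: "('s, 'a) proc \<Rightarrow> bool" where
  "proc_wf P \<longleftrightarrow> finite (pstates P) \<and> finite (pactions P) \<and>
     (\<forall>s\<in>pstates P. \<forall>a\<in>pactions P. set_spmf (ptrans P s a) \<subseteq> pstates P)"

definition available :: "('s, 'a) proc \<Rightarrow> 's \<Rightarrow> 'a set" where
  "available P s = {a \<in> pactions P. \<exists>s'. spmf (ptrans P s a) s' > 0}"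

text \<open>
  A finite run \<open>s\<^sub>0 a\<^sub>0 s\<^sub>1 a\<^sub>1 \<dots> s\<^sub>n\<close> is the pair of \<open>s\<^sub>0\<close> and the list of the \<open>(a\<^sub>i, s\<^sub>i\<^sub>+\<^sub>1)\<close>.
\<close>

type_synonym ('s, 'a) frun = "'s \<times> ('a \<times> 's) list"

fun last_state :: "('s, 'a) frun \<Rightarrow> 's" where
  "last_state (s, h) = (if h = [] then s else snd (last h))"

fun is_path :: "('s, 'a) proc \<Rightarrow> 's \<Rightarrow> ('a \<times> 's) list \<Rightarrow> bool" where
  "is_path P s [] \<longleftrightarrow> s \<in> pstates P"
| "is_path P s ((a, s') # h) \<longleftrightarrow>
     s \<in> pstates P \<and> a \<in> pactions P \<and> spmf (ptrans P s a) s' > 0 \<and> is_path P s' h"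

definition finite_runs :: "('s, 'a) proc \<Rightarrow> ('s, 'a) frun set" where
  "finite_runs P = {(s, h). is_path P s h}"

type_synonym ('s, 'a) strategy = "('s, 'a) frun \<Rightarrow> 'a pmf"

text \<open>
  There is no constraint at a state without available actions; by \<open>next_step\<close> below, a run that
  reaches such a state stops there.
\<close>

definition strategies :: "('s, 'a) proc \<Rightarrow> ('s, 'a) strategy set" where
  "strategies P = {f. \<forall>r\<in>finite_runs P. available P (last_state r) \<noteq> {} \<longrightarrow>
     set_pmf (f r) \<subseteq> available P (last_state r)}"

text \<open>
  A run from a fixed state is a sequence whose \<open>i\<close>-th entry is \<open>Some (a\<^sub>i, s\<^sub>i\<^sub>+\<^sub>1)\<close>, or \<open>None\<close> once the
  computation has stopped.
\<close>

type_synonym ('s, 'a) run = "nat \<Rightarrow> ('a \<times> 's) option"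

definition history :: "('s, 'a) run \<Rightarrow> nat \<Rightarrow> ('a \<times> 's) list" where
  "history \<omega> n = map (\<lambda>i. the (\<omega> i)) [0..<n]"

definition next_step :: "('s, 'a) proc \<Rightarrow> ('s, 'a) strategy \<Rightarrow> 's \<Rightarrow> nat \<Rightarrow> ('s, 'a) run
    \<Rightarrow> ('a \<times> 's) option pmf" where
  "next_step P f s n \<omega> =
    (let h = history \<omega> n; x = last_state (s, h) in
     if (\<forall>i<n. \<omega> i \<noteq> None) \<and> is_path P s h \<and> available P x \<noteq> {}
     then bind_pmf (f (s, h)) (\<lambda>a. map_spmf (\<lambda>y. (a, y)) (ptrans P x a))
     else return_pmf None)"

definition steps :: "('s, 'a) proc \<Rightarrow> ('a \<times> 's) option set" where
  "steps P = insert None (Some ` (pactions P \<times> pstates P))"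

definition step_measure :: "('s, 'a) proc \<Rightarrow> ('s, 'a) strategy \<Rightarrow> 's \<Rightarrow> nat \<Rightarrow> ('s, 'a) run
    \<Rightarrow> ('a \<times> 's) option measure" where
  "step_measure P f s n \<omega> = restrict_space (measure_pmf (next_step P f s n \<omega>)) (steps P)"

text \<open>
  The measure on infinite sequences given by the Ionescu-Tulcea theorem; its assumptions are
  discharged in \<open>Ionescu_Tulcea_step_measure\<close>.
\<close>

definition run_measure :: "('s, 'a) proc \<Rightarrow> ('s, 'a) strategy \<Rightarrow> 's \<Rightarrow> ('s, 'a) run measure" where
  "run_measure P f s =
     projective_family.lim UNIV
       (Ionescu_Tulcea.CI (step_measure P f s) (\<lambda>_. count_space (steps P)))
       (\<lambda>_. count_space (steps P))"

definition run_state :: "'s \<Rightarrow> ('s, 'a) run \<Rightarrow> nat \<Rightarrow> 's" where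
  "run_state s \<omega> n = last_state (s, history \<omega> n)"

definition transition :: "'s \<Rightarrow> ('s, 'a) run \<Rightarrow> nat \<Rightarrow> 's \<times> 'a \<times> 's" where
  "transition s \<omega> i = (run_state s \<omega> i, the (\<omega> i))"

definition accepting_positions :: "('s \<times> 'a \<times> 's) set \<Rightarrow> 's \<Rightarrow> ('s, 'a) run \<Rightarrow> nat set" where
  "accepting_positions F s \<omega> = {i. (\<forall>j\<le>i. \<omega> j \<noteq> None) \<and> transition s \<omega> i \<in> F}"

definition n_accepting :: "('s \<times> 'a \<times> 's) set \<Rightarrow> 's \<Rightarrow> ('s, 'a) run \<Rightarrow> enat" where
  "n_accepting F s \<omega> =
     (if finite (accepting_positions F s \<omega>) then enat (card (accepting_positions F s \<omega>)) else \<infinity>)"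


section \<open>Buechi automata, MDPs and their product\<close>

record ('l, 'q) buchi =
  alphabet :: "'l set"
  bstates :: "'q set"
  binit :: "'q"
  bdelta :: "('q \<times> 'l \<times> 'q) set"
  bacc :: "('q \<times> 'l \<times> 'q) set"

definition is_buchi :: "('l, 'q) buchi \<Rightarrow> bool" where
  "is_buchi A \<longleftrightarrow> finite (alphabet A) \<and> finite (bstates A) \<and> binit A \<in> bstates A \<and>
     bdelta A \<subseteq> bstates A \<times> alphabet A \<times> bstates A \<and>
     bacc A \<subseteq> bstates A \<times> alphabet A \<times> bstates A"

definition lang :: "('l, 'q) buchi \<Rightarrow> (nat \<Rightarrow> 'l) set" where
  "lang A = {w. (\<forall>i. w i \<in> alphabet A) \<and>
     (\<exists>\<rho>. \<rho> 0 = binit A \<and> (\<forall>i. (\<rho> i, w i, \<rho> (Suc i)) \<in> bdelta A) \<and>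
          (\<exists>t\<in>bacc A. \<exists>\<^sub>\<infinity>i. (\<rho> i, w i, \<rho> (Suc i)) = t))}"

record ('s, 'a, 'l) mdp =
  mstates :: "'s set"
  mactions :: "'a set"
  mtrans :: "'s \<Rightarrow> 'a \<Rightarrow> 's pmf"
  malphabet :: "'l set"
  mlabel :: "'s \<Rightarrow> 'a \<Rightarrow> 's \<Rightarrow> 'l"

definition is_mdp :: "('s, 'a, 'l) mdp \<Rightarrow> bool" where
  "is_mdp M \<longleftrightarrow> finite (mstates M) \<and> finite (mactions M) \<and> finite (malphabet M) \<and>
     (\<forall>s\<in>mstates M. \<forall>a\<in>mactions M. set_pmf (mtrans M s a) \<subseteq> mstates M) \<and>
     (\<forall>s\<in>mstates M. \<forall>a\<in>mactions M. \<forall>s'\<in>mstates M. mlabel M s a s' \<in> malphabet M)"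

definition mdp_proc :: "('s, 'a, 'l) mdp \<Rightarrow> ('s, 'a) proc" where
  "mdp_proc M = \<lparr>pstates = mstates M, pactions = mactions M,
     ptrans = (\<lambda>s a. spmf_of_pmf (mtrans M s a))\<rparr>"

definition run_word :: "('s, 'a, 'l) mdp \<Rightarrow> 's \<Rightarrow> ('s, 'a) run \<Rightarrow> nat \<Rightarrow> 'l" where
  "run_word M s \<omega> i = (case transition s \<omega> i of (x, a, x') \<Rightarrow> mlabel M x a x')"

definition product :: "('s, 'a, 'l) mdp \<Rightarrow> ('l, 'q) buchi \<Rightarrow> ('s \<times> 'q, 'a \<times> 'q) proc" where
  "product M A = \<lparr>pstates = mstates M \<times> bstates A, pactions = mactions M \<times> bstates A,
     ptrans = (\<lambda>(s, q) (a, q').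
       map_pmf (\<lambda>s'. if (q, mlabel M s a s', q') \<in> bdelta A then Some (s', q') else None)
         (mtrans M s a))\<rparr>"

definition product_acc ::
    "('s, 'a, 'l) mdp \<Rightarrow> ('l, 'q) buchi \<Rightarrow> (('s \<times> 'q) \<times> ('a \<times> 'q) \<times> ('s \<times> 'q)) set" where
  "product_acc M A = {((s, q), (a, q'), (s', q')) | s q a q' s'.
     s \<in> mstates M \<and> a \<in> mactions M \<and> s' \<in> mstates M \<and>
     (q, mlabel M s a s', q') \<in> bacc A \<and> pmf (mtrans M s a) s' > 0}"

text \<open>
  States and actions are finite sets and enter only up to renaming, so MDPs over \<open>nat\<close> represent
  all MDPs.
\<close>

definition good_for_mdps :: "('l, 'q) buchi \<Rightarrow> bool" where
  "good_for_mdps A \<longleftrightarrow>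
    (\<forall>M :: (nat, nat, 'l) mdp. is_mdp M \<and> malphabet M = alphabet A \<longrightarrow>
      (\<forall>s\<in>mstates M.
        (SUP f\<in>strategies (product M A).
           emeasure (run_measure (product M A) f (s, binit A))
             {\<omega> \<in> space (run_measure (product M A) f (s, binit A)).
                infinite (accepting_positions (product_acc M A) (s, binit A) \<omega>)}) =
        (SUP f\<in>strategies (mdp_proc M).
           emeasure (run_measure (mdp_proc M) f s)
             {\<omega> \<in> space (run_measure (mdp_proc M) f s).
                (\<forall>i. \<omega> i \<noteq> None) \<and> run_word M s \<omega> \<in> lang A})))"


section \<open>Biased discounted reward and the total reward with a sink\<close>

definition Disct :: "real \<Rightarrow> enat \<Rightarrow> ennreal" where
  "Disct \<zeta> n = (\<Sum>i. if enat i < n then ennreal (\<zeta> ^ i) else 0)"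

definition EDisct :: "('s, 'a, 'l) mdp \<Rightarrow> ('l, 'q) buchi \<Rightarrow> real \<Rightarrow> 's \<times> 'q
    \<Rightarrow> ('s \<times> 'q, 'a \<times> 'q) strategy \<Rightarrow> ennreal" where
  "EDisct M A \<zeta> x f =
     (\<integral>\<^sup>+\<omega>. Disct \<zeta> (n_accepting (product_acc M A) x \<omega>) \<partial>run_measure (product M A) f x)"

datatype 'x with_sink = State (unsink: 'x) | Sink

definition add_sink :: "real \<Rightarrow> ('x, 'b) proc \<Rightarrow> ('x \<times> 'b \<times> 'x) set \<Rightarrow> ('x with_sink, 'b) proc" where
  "add_sink \<zeta> P F = \<lparr>pstates = insert Sink (State ` pstates P), pactions = pactions P,
     ptrans = (\<lambda>x b. case x of
        State x \<Rightarrow> bind_spmf (ptrans P x b)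
          (\<lambda>y. if (x, b, y) \<in> F
               then spmf_of_pmf (map_pmf (\<lambda>c. if c then State y else Sink) (bernoulli_pmf \<zeta>))
               else return_spmf (State y))
      | Sink \<Rightarrow> return_pmf None)\<rparr>"

text \<open>
  Transitions into the sink count as accepting: they only arise from accepting transitions.
\<close>

definition sink_acc :: "('x \<times> 'b \<times> 'x) set \<Rightarrow> ('x with_sink \<times> 'b \<times> 'x with_sink) set" where
  "sink_acc F = {(State x, b, State y) | x b y. (x, b, y) \<in> F} \<union> {(State x, b, Sink) | x b. True}"

text \<open>
  A finite run that has not reached the sink is a finite run of the original process, and on it the
  same choice is made. In the sink no choice is made, so \<open>unsink Sink\<close> is irrelevant.
\<close>

definition lift_strategy :: "('x, 'b) strategy \<Rightarrow> ('x with_sink, 'b) strategy" where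
  "lift_strategy f = (\<lambda>(x, h). f (unsink x, map (\<lambda>(b, y). (b, unsink y)) h))"

definition ETotal :: "('s, 'a, 'l) mdp \<Rightarrow> ('l, 'q) buchi \<Rightarrow> real \<Rightarrow> 's \<times> 'q
    \<Rightarrow> ('s \<times> 'q, 'a \<times> 'q) strategy \<Rightarrow> ennreal" where
  "ETotal M A \<zeta> x f =
     (\<integral>\<^sup>+\<omega>. ennreal_of_enat (n_accepting (sink_acc (product_acc M A)) (State x) \<omega>)
        \<partial>run_measure (add_sink \<zeta> (product M A) (product_acc M A)) (lift_strategy f) (State x))"


section \<open>Adequacy of the definitions\<close>

declare last_state.simps [simp del]

lemma last_state_in_pstates:
  assumes "is_path P s h"
  shows "last_state (s, h) \<in> pstates P"
  using assms
proof (induction P s h rule: is_path.induct)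
  case (2 P s a s' h)
  then show ?case
    by (cases h) (auto simp: last_state.simps)
qed (simp add: last_state.simps)

lemma set_next_step:
  assumes "proc_wf P" "f \<in> strategies P"
  shows "set_pmf (next_step P f s n \<omega>) \<subseteq> steps P"
proof (cases "is_path P s (history \<omega> n) \<and> available P (last_state (s, history \<omega> n)) \<noteq> {}")
  case True
  let ?x = "last_state (s, history \<omega> n)"
  have x: "?x \<in> pstates P"
    using True by (auto intro: last_state_in_pstates)
  have "(s, history \<omega> n) \<in> finite_runs P"
    using True by (simp add: finite_runs_def)
  with True assms(2) have f: "set_pmf (f (s, history \<omega> n)) \<subseteq> available P ?x"
    unfolding strategies_def by blast
  have "Some (a, y) \<in> steps P" if "a \<in> set_pmf (f (s, history \<omega> n))" "Some y \<in> set_pmf (ptrans P ?x a)" for a y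
  proof -
    have a: "a \<in> pactions P"
      using f that(1) by (auto simp: available_def)
    have "y \<in> set_spmf (ptrans P ?x a)"
      using that(2) by (simp add: in_set_spmf)
    with a x assms(1) have "y \<in> pstates P"
      unfolding proc_wf_def by blast
    with a show ?thesis
      by (auto simp: steps_def)
  qed
  moreover have "None \<in> steps P"
    by (simp add: steps_def)
  ultimately show ?thesis
    unfolding next_step_def Let_def
    by (auto simp: map_option_case split: option.splits)
qed (auto simp: next_step_def Let_def steps_def)

lemma Ionescu_Tulcea_step_measure:
  fixes P :: "('s, 'a) proc"
  assumes "proc_wf P" "f \<in> strategies P"
  shows "Ionescu_Tulcea (step_measure P f s) (\<lambda>_. count_space (steps P))"
proof (rule Ionescu_Tulcea.intro)
  have fin: "finite (steps P)"
    using assms by (auto simp: steps_def proc_wf_def)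
  have prob: "prob_space (step_measure P f s n \<omega>)" for n \<omega>
  proof (rule prob_spaceI)
    have "emeasure (measure_pmf (next_step P f s n \<omega>)) (steps P) = 1"
      using set_next_step[OF assms]
      by (intro measure_pmf.emeasure_eq_1_AE) (auto simp: AE_measure_pmf_iff)
    then show "emeasure (step_measure P f s n \<omega>) (space (step_measure P f s n \<omega>)) = 1"
      by (simp add: step_measure_def space_restrict_space emeasure_restrict_space)
  qed
  show "prob_space (step_measure P f s i x)" for i and x :: "('s, 'a) run"
    by (rule prob)
  have sets: "sets (step_measure P f s n \<omega>) = Pow (steps P)" for n \<omega>
    by (auto simp: step_measure_def sets_restrict_space)
  show "step_measure P f s n \<in> PiM {0..<n} (\<lambda>_. count_space (steps P)) \<rightarrow>\<^sub>M
      subprob_algebra (count_space (steps P))" for n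
    using fin prob sets
    by (subst count_space_PiM_finite)
       (auto simp: countable_finite space_subprob_algebra intro: prob_space_imp_subprob_space)
qed

lemma space_run_measure:
  assumes "proc_wf P" "f \<in> strategies P"
  shows "space (run_measure P f s) = (UNIV \<rightarrow>\<^sub>E steps P)"
proof -
  interpret Ionescu_Tulcea "step_measure P f s" "\<lambda>_. count_space (steps P)"
    by (rule Ionescu_Tulcea_step_measure[OF assms])
  show ?thesis
    by (simp add: run_measure_def space_PiM)
qed

lemma prob_space_run_measure:
  assumes "proc_wf P" "f \<in> strategies P"
  shows "prob_space (run_measure P f s)"
proof -
  interpret Ionescu_Tulcea "step_measure P f s" "\<lambda>_. count_space (steps P)"
    by (rule Ionescu_Tulcea_step_measure[OF assms])
  have "prob_space (distr PF.lim (PiM {} (\<lambda>_. count_space (steps P))) (\<lambda>x. restrict x {}))"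
    by (subst distr_lim) (auto intro: PF.prob_space_P)
  then show ?thesis
    unfolding run_measure_def
    by (rule prob_space_distrD[rotated])
      (unfold measurable_cong_sets[OF PF.sets_lim refl], rule measurable_restrict, simp)
qed

lemma proc_wf_mdp_proc: "is_mdp M \<Longrightarrow> proc_wf (mdp_proc M)"
  by (auto simp: is_mdp_def proc_wf_def mdp_proc_def)

lemma available_mdp_proc: "available (mdp_proc M) s = mactions M"
proof -
  have "\<exists>s'. spmf (spmf_of_pmf (mtrans M s a)) s' > 0" for a
    using set_pmf_not_empty[of "mtrans M s a"] by (auto simp: pmf_positive_iff)
  then show ?thesis
    by (simp add: available_def mdp_proc_def)
qed

lemma proc_wf_product: "is_mdp M \<Longrightarrow> is_buchi A \<Longrightarrow> proc_wf (product M A)"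
  by (fastforce simp: is_mdp_def is_buchi_def proc_wf_def product_def in_set_spmf split: if_splits)

lemma spmf_product:
  "spmf (ptrans (product M A) (s, q) (a, q')) (s', q'') =
     (if q'' = q' \<and> (q, mlabel M s a s', q') \<in> bdelta A then pmf (mtrans M s a) s' else 0)"
proof -
  let ?g = "\<lambda>s'. if (q, mlabel M s a s', q') \<in> bdelta A then Some (s', q') else None"
  have "?g -` {Some (s', q'')} = (if q'' = q' \<and> (q, mlabel M s a s', q') \<in> bdelta A then {s'} else {})"
    by (auto split: if_splits)
  then show ?thesis
    by (simp add: product_def pmf_map measure_pmf_single)
qed

lemma ptrans_add_sink_State:
  "ptrans (add_sink \<zeta> P F) (State x) b = bind_spmf (ptrans P x b)
     (\<lambda>y. if (x, b, y) \<in> F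
          then spmf_of_pmf (map_pmf (\<lambda>c. if c then State y else Sink) (bernoulli_pmf \<zeta>))
          else return_spmf (State y))"
  by (simp add: add_sink_def)

lemma pmf_bernoulli_sink:
  assumes "0 \<le> \<zeta>" "\<zeta> \<le> 1"
  shows "pmf (map_pmf (\<lambda>c. if c then State z else Sink) (bernoulli_pmf \<zeta>)) u =
    (if u = State z then \<zeta> else if u = Sink then 1 - \<zeta> else 0)"
proof -
  have "(\<lambda>c. if c then State z else Sink) -` {u} =
      (if u = State z then {True} else if u = Sink then {False} else {})"
    by (auto split: if_splits)
  then show ?thesis
    using assms by (simp add: pmf_map measure_pmf_single)
qed

lemma spmf_add_sink_State:
  assumes "0 \<le> \<zeta>" "\<zeta> \<le> 1"
  shows "spmf (ptrans (add_sink \<zeta> P F) (State x) b) (State y) =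
    spmf (ptrans P x b) y * (if (x, b, y) \<in> F then \<zeta> else 1)"
proof -
  have "spmf (ptrans (add_sink \<zeta> P F) (State x) b) (State y) =
      (\<integral>z. (if (x, b, y) \<in> F then \<zeta> else 1) * indicat_real {y} z \<partial>measure_spmf (ptrans P x b))"
    unfolding ptrans_add_sink_State spmf_bind
    using assms by (intro Bochner_Integration.integral_cong) (auto simp: pmf_bernoulli_sink)
  then show ?thesis
    by (simp add: spmf_conv_measure_spmf)
qed

lemma spmf_add_sink_Sink:
  assumes "0 \<le> \<zeta>" "\<zeta> \<le> 1" "proc_wf P" "x \<in> pstates P" "b \<in> pactions P"
  shows "spmf (ptrans (add_sink \<zeta> P F) (State x) b) Sink =
    (\<Sum>y | y \<in> pstates P \<and> (x, b, y) \<in> F. spmf (ptrans P x b) y * (1 - \<zeta>))"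
proof -
  let ?p = "ptrans P x b" and ?c = "\<lambda>y. if (x, b, y) \<in> F then 1 - \<zeta> else 0"
  have fin: "finite (pstates P)" and sub: "set_spmf ?p \<subseteq> pstates P"
    using assms by (auto simp: proc_wf_def)
  then have zero: "spmf ?p y = 0" if "y \<notin> pstates P" for y
    using that by (auto simp: spmf_eq_0_set_spmf)
  have "spmf (ptrans (add_sink \<zeta> P F) (State x) b) Sink = (\<integral>y. ?c y \<partial>measure_spmf ?p)"
    unfolding ptrans_add_sink_State spmf_bind
    using assms by (intro Bochner_Integration.integral_cong) (auto simp: pmf_bernoulli_sink)
  also have "\<dots> = (\<integral>y. spmf ?p y * ?c y \<partial>count_space UNIV)"
    using assms by (intro integral_measure_spmf measure_spmf.integrable_const_bound[where B=1]) auto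
  also have "\<dots> = (\<Sum>y | y \<in> UNIV \<and> spmf ?p y * ?c y \<noteq> 0. spmf ?p y * ?c y)"
    using zero by (intro lebesgue_integral_count_space_finite_support finite_subset[OF _ fin]) auto
  also have "\<dots> = (\<Sum>y\<in>pstates P. spmf ?p y * ?c y)"
    using zero by (intro sum.mono_neutral_left[OF fin]) auto
  also have "\<dots> = (\<Sum>y | y \<in> pstates P \<and> (x, b, y) \<in> F. spmf ?p y * (1 - \<zeta>))"
    using fin by (intro sum.mono_neutral_cong_right) auto
  finally show ?thesis .
qed

lemma spmf_add_sink_from_Sink: "spmf (ptrans (add_sink \<zeta> P F) Sink b) u = 0"
  by (simp add: add_sink_def)

lemma available_add_sink_Sink: "available (add_sink \<zeta> P F) Sink = {}"
  by (simp add: available_def spmf_add_sink_from_Sink)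

lemma available_add_sink_State:
  assumes "0 < \<zeta>" "\<zeta> < 1"
  shows "available (add_sink \<zeta> P F) (State x) = available P x"
proof -
  have "(\<exists>u. spmf (ptrans (add_sink \<zeta> P F) (State x) b) u > 0) \<longleftrightarrow> (\<exists>y. spmf (ptrans P x b) y > 0)" for b
  proof
    assume "\<exists>u. spmf (ptrans (add_sink \<zeta> P F) (State x) b) u > 0"
    then obtain u where "u \<in> set_spmf (ptrans (add_sink \<zeta> P F) (State x) b)"
      by (auto simp: in_set_spmf_iff_spmf less_le)
    then obtain y where "y \<in> set_spmf (ptrans P x b)"
      unfolding ptrans_add_sink_State by (auto simp: set_bind_spmf)
    then show "\<exists>y. spmf (ptrans P x b) y > 0"
      by (auto simp: in_set_spmf_iff_spmf less_le)
  next
    assume "\<exists>y. spmf (ptrans P x b) y > 0"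
    then obtain y where "spmf (ptrans P x b) y > 0" ..
    with assms have "spmf (ptrans (add_sink \<zeta> P F) (State x) b) (State y) > 0"
      by (subst spmf_add_sink_State) auto
    then show "\<exists>u. spmf (ptrans (add_sink \<zeta> P F) (State x) b) u > 0" ..
  qed
  then show ?thesis
    by (simp add: available_def) (simp add: add_sink_def)
qed

lemma proc_wf_add_sink:
  assumes "proc_wf P"
  shows "proc_wf (add_sink \<zeta> P F)"
  using assms unfolding proc_wf_def add_sink_def
  by (fastforce simp: set_bind_spmf split: if_splits)

lemma is_path_unsink:
  assumes "0 < \<zeta>" "\<zeta> < 1" "is_path (add_sink \<zeta> P F) x h" "last_state (x, h) \<noteq> Sink"
  shows "x \<noteq> Sink \<and> is_path P (unsink x) (map (\<lambda>(b, y). (b, unsink y)) h) \<and>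
    last_state (unsink x, map (\<lambda>(b, y). (b, unsink y)) h) = unsink (last_state (x, h))"
  using assms(3,4)
proof (induction h arbitrary: x)
  case Nil
  then show ?case
    by (auto simp: last_state.simps add_sink_def)
next
  case (Cons by' h)
  obtain b y where by': "by' = (b, y)"
    by (cases by')
  have last: "last_state (x, (b, y) # h) = last_state (y, h)"
    by (simp add: last_state.simps)
  have IH: "y \<noteq> Sink" "is_path P (unsink y) (map (\<lambda>(b, y). (b, unsink y)) h)"
     "last_state (unsink y, map (\<lambda>(b, y). (b, unsink y)) h) = unsink (last_state (y, h))"
    using Cons.IH[of y] Cons.prems unfolding by' last by auto
  have pos: "spmf (ptrans (add_sink \<zeta> P F) x b) y > 0" and b: "b \<in> pactions (add_sink \<zeta> P F)"
    and x: "x \<in> pstates (add_sink \<zeta> P F)"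
    using Cons.prems by (auto simp: by')
  obtain x' where x': "x = State x'"
    using pos by (cases x) (auto simp: spmf_add_sink_from_Sink)
  obtain y' where y': "y = State y'"
    using IH(1) by (cases y) auto
  have "spmf (ptrans P x' b) y' > 0"
    using pos assms(1,2)
    by (auto simp: x' y' spmf_add_sink_State zero_less_mult_iff split: if_splits)
  then show ?case
    using IH b x Cons.prems
    by (auto simp: by' x' y' last_state.simps add_sink_def)
qed

lemma lift_strategy_in_strategies:
  fixes P :: "('x, 'b) proc"
  assumes "0 < \<zeta>" "\<zeta> < 1" "f \<in> strategies P"
  shows "lift_strategy f \<in> strategies (add_sink \<zeta> P F)"
  unfolding strategies_def
proof (intro CollectI ballI impI)
  fix r :: "('x with_sink, 'b) frun"
  obtain x h where r: "r = (x, h)"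
    by (cases r)
  let ?P = "add_sink \<zeta> P F" and ?h = "map (\<lambda>(b, y). (b, unsink y)) h"
  assume "r \<in> finite_runs ?P" and av': "available ?P (last_state r) \<noteq> {}"
  then have path: "is_path ?P x h"
    by (simp add: finite_runs_def r)
  from av' have av: "available ?P (last_state (x, h)) \<noteq> {}"
    by (simp add: r)
  then obtain z where z: "last_state (x, h) = State z"
    by (cases "last_state (x, h)") (auto simp: available_add_sink_Sink)
  with is_path_unsink[OF assms(1,2) path]
  have "(unsink x, ?h) \<in> finite_runs P" "last_state (unsink x, ?h) = z"
    by (auto simp: finite_runs_def)
  then show "set_pmf (lift_strategy f r) \<subseteq> available ?P (last_state r)"
    using assms av unfolding strategies_def
    by (force simp: r z available_add_sink_State lift_strategy_def)
qed

end

theory Submission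
  imports Defs
begin

text \<open>
  Both expectations are series over the time \<open>i\<close>. The \<open>i\<close>-th term on the discounted side is the
  expectation of \<open>\<zeta>\<close> to the number of accepting transitions before time \<open>i\<close>, on the event that the
  transition at time \<open>i\<close> is accepting. On the other side it is the probability that the transition at
  time \<open>i\<close> is accepting. The two agree because the factor \<open>\<zeta> ^ k\<close> is exactly the probability of not
  having been diverted to the sink by \<open>k\<close> accepting transitions, while the accepting transition at
  time \<open>i\<close> itself counts in both of its outcomes, of probabilities \<open>\<zeta>\<close> and \<open>1 - \<zeta>\<close>.
\<close>

section \<open>Finite-dimensional marginals of the Ionescu-Tulcea measure\<close>

text \<open>The marginal of the limit on the first \<open>n\<close> coordinates is the finite
  composition of kernels \<open>C 0 n\<close>.\<close>

lemma (in Ionescu_Tulcea) nn_integral_lim_restrict: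
  assumes G: "G \<in> borel_measurable (PiM {0..<n} M)"
  shows "(\<integral>\<^sup>+\<omega>. G (restrict \<omega> {0..<n}) \<partial>PF.lim) = (\<integral>\<^sup>+\<omega>. G \<omega> \<partial>C 0 n (\<lambda>_. undefined))"
proof -
  have x0: "(\<lambda>_. undefined) \<in> space (PiM {0..<0} M)"
    by (simp add: space_PiM)
  have rm: "(\<lambda>\<omega>. restrict \<omega> {0..<n}) \<in> PF.lim \<rightarrow>\<^sub>M PiM {0..<n} M"
    unfolding measurable_cong_sets[OF PF.sets_lim refl]
    by (rule measurable_restrict) (simp add: measurable_component_singleton)
  have "distr PF.lim (PiM {0..<n} M) (\<lambda>\<omega>. restrict \<omega> {0..<n}) = C 0 n (\<lambda>_. undefined)"
  proof (subst distr_lim)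
    show "CI {0..<n} = C 0 n (\<lambda>_. undefined)"
    proof (rule measure_eqI)
      fix X assume "X \<in> sets (CI {0..<n})"
      then have X: "X \<in> sets (PiM {0..<n} M)"
        by (simp add: CI_def)
      then have "PF.emb {0..<n} {0..<n} X = X"
        by (intro prod_emb_id) (use sets.sets_into_space[OF X] in \<open>simp add: space_PiM\<close>)
      with X show "emeasure (CI {0..<n}) X = emeasure (C 0 n (\<lambda>_. undefined)) X"
        by (subst emeasure_CI[of _ n]) auto
    qed (use sets_C[OF x0] in \<open>simp add: CI_def\<close>)
  qed simp
  then show ?thesis
    using nn_integral_distr[OF rm, unfolded measurable_distr_eq1, OF G] by simp
qed

text \<open>Since \<open>C 0 (Suc n)\<close> is \<open>C 0 n\<close> followed by the kernel
  \<open>eP n\<close>, the last coordinate can be integrated out first. The outer integral then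
  returns to the limit measure, so that all times share one space.\<close>

lemma (in Ionescu_Tulcea) nn_integral_lim_Suc:
  assumes G: "G \<in> borel_measurable (PiM {0..<Suc n} M)"
  shows "(\<integral>\<^sup>+\<omega>. G (restrict \<omega> {0..<Suc n}) \<partial>PF.lim) =
    (\<integral>\<^sup>+\<omega>. (\<integral>\<^sup>+z. G ((restrict \<omega> {0..<n})(n := z)) \<partial>P n (restrict \<omega> {0..<n})) \<partial>PF.lim)"
proof -
  have x0: "(\<lambda>_. undefined) \<in> space (PiM {0..<0} M)"
    by (simp add: space_PiM)
  let ?H = "\<lambda>\<omega>. \<integral>\<^sup>+z. G z \<partial>eP n \<omega>"
  have H: "?H \<in> borel_measurable (PiM {0..<n} M)"
    by (rule measurable_compose[OF measurable_eP nn_integral_measurable_subprob_algebra[OF G]])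
  have "(\<integral>\<^sup>+\<omega>. G (restrict \<omega> {0..<Suc n}) \<partial>PF.lim) = (\<integral>\<^sup>+\<omega>. G \<omega> \<partial>(C 0 n (\<lambda>_. undefined) \<bind> eP n))"
    by (subst nn_integral_lim_restrict[OF G]) simp
  also have "\<dots> = (\<integral>\<^sup>+\<omega>. ?H \<omega> \<partial>C 0 n (\<lambda>_. undefined))"
    using measurable_eP sets_C[OF x0, of n]
    by (subst nn_integral_bind[OF G]) (simp_all cong: measurable_cong_sets)
  also have "\<dots> = (\<integral>\<^sup>+\<omega>. ?H (restrict \<omega> {0..<n}) \<partial>PF.lim)"
    by (rule nn_integral_lim_restrict[symmetric]) (rule H)
  also have "\<dots> = (\<integral>\<^sup>+\<omega>. (\<integral>\<^sup>+z. G ((restrict \<omega> {0..<n})(n := z)) \<partial>P n (restrict \<omega> {0..<n})) \<partial>PF.lim)"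
    by (intro nn_integral_cong nn_integral_eP G) (simp add: space_PiM PiE_iff)
  finally show ?thesis .
qed

lemma nn_integral_bind_spmf:
  "(\<integral>\<^sup>+x. g x \<partial>measure_spmf (bind_spmf p k)) = (\<integral>\<^sup>+x. \<integral>\<^sup>+y. g y \<partial>measure_spmf (k x) \<partial>measure_spmf p)"
  unfolding measure_spmf_bind o_def
  by (rule nn_integral_bind[where B = "count_space UNIV"]) (auto simp: space_subprob_algebra)

lemma nn_integral_measure_spmf_bind_pmf:
  "(\<integral>\<^sup>+x. g x \<partial>measure_spmf (bind_pmf p k)) = (\<integral>\<^sup>+x. \<integral>\<^sup>+y. g y \<partial>measure_spmf (k x) \<partial>measure_pmf p)"
  unfolding measure_spmf_bind_pmf o_def
  by (rule nn_integral_bind[where B = "count_space UNIV"]) (auto simp: space_subprob_algebra)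

lemma nn_integral_measure_spmf_option:
  "(\<integral>\<^sup>+x. g x \<partial>measure_spmf p) = (\<integral>\<^sup>+z. (if z \<noteq> None then g (the z) else 0) \<partial>measure_pmf p)"
  unfolding measure_spmf_def
  by (subst nn_integral_distr)
    (auto simp: nn_integral_restrict_space intro!: nn_integral_cong split: split_indicator)

section \<open>Series indexed by rank and by position\<close>

text \<open>An element of \<open>X\<close> with \<open>k\<close> elements of \<open>X\<close> below
  it carries the weight \<open>c k\<close>, so both series list \<open>c 0\<close>,
  \<open>c 1\<close>, ... up to the size of \<open>X\<close>, the right one with zeros interspersed.
  This turns indexing by the number of the reward into indexing by time.\<close>

lemma suminf_card_reindex:
  fixes c :: "nat \<Rightarrow> ennreal" and X :: "nat set"
  defines "N \<equiv> if finite X then enat (card X) else \<infinity>"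
  shows "(\<Sum>i. if enat i < N then c i else 0) = (\<Sum>i. if i \<in> X then c (card (X \<inter> {..<i})) else 0)"
proof -
  let ?l = "\<lambda>i. if enat i < N then c i else 0" and ?r = "\<lambda>i. if i \<in> X then c (card (X \<inter> {..<i})) else 0"
  have le: "enat (card (X \<inter> {..<n})) \<le> N" for n
    by (auto simp: N_def intro!: card_mono)
  \<comment> \<open>Up to \<open>n\<close>, the right series has collected an initial segment of
    \<open>c\<close>, as long as the number of elements of \<open>X\<close> below
    \<open>n\<close>.\<close>
  have r: "sum ?r {..<n} = sum c {..<card (X \<inter> {..<n})}" for n
    by (induction n) (simp_all add: lessThan_Suc Int_insert_right)
  have l: "sum ?l {..<card (X \<inter> {..<n})} = sum c {..<card (X \<inter> {..<n})}" for n
    by (rule sum.cong[OF refl]) (use le[of n] in \<open>auto simp: less_le_trans[of "enat _" "enat _"]\<close>)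
  have ex: "\<exists>n. k \<le> card (X \<inter> {..<n})" if k: "enat k \<le> N" for k
  proof -
    obtain Y where "finite Y" "Y \<subseteq> X" "card Y = k"
      using k infinite_arbitrarily_large[of X k] obtain_subset_with_card_n[of k X]
      by (metis N_def enat_ord_simps(1))
    moreover obtain n where "Y \<subseteq> {..<n}"
      using finite_nat_iff_bounded \<open>finite Y\<close> by blast
    ultimately show ?thesis
      by (intro exI[of _ n]) (metis card_mono finite_Int finite_lessThan inf_greatest)
  qed
  have "(\<Sum>i. ?l i) = (SUP n. sum ?l {..<n})"
    by (rule suminf_eq_SUP)
  also have "\<dots> = (SUP n. sum ?r {..<n})"
  proof (rule antisym)
    show "(SUP n. sum ?l {..<n}) \<le> (SUP n. sum ?r {..<n})"
    proof (rule SUP_least)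
      fix n
      \<comment> \<open>This is the minimum of \<open>n\<close> and \<open>N\<close>;
        \<open>the_enat\<close> is applied only if \<open>N\<close> is below \<open>n\<close>, hence
        finite.\<close>
      define k where "k = (if enat n \<le> N then n else the_enat N)"
      have kN: "enat k \<le> N" and kn: "k \<le> n"
        by (cases N; auto simp: k_def)+
      have "sum ?l {..<n} = sum c {..<k}"
        by (rule sum.mono_neutral_cong_right) (use kN kn in \<open>cases N; auto simp: k_def\<close>)+
      moreover obtain m where "k \<le> card (X \<inter> {..<m})"
        using ex[OF kN] by blast
      ultimately have "sum ?l {..<n} \<le> sum ?r {..<m}"
        unfolding r by (auto intro: sum_mono2)
      then show "sum ?l {..<n} \<le> (SUP n. sum ?r {..<n})"
        by (rule SUP_upper2[rotated]) simp
    qed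
    show "(SUP n. sum ?r {..<n}) \<le> (SUP n. sum ?l {..<n})"
      by (rule SUP_least) (auto simp only: r l[symmetric] intro: SUP_upper)
  qed
  also have "\<dots> = (\<Sum>i. ?r i)"
    by (rule suminf_eq_SUP[symmetric])
  finally show ?thesis .
qed

lemma ennreal_of_enat_eq_suminf: "ennreal_of_enat N = (\<Sum>i. if enat i < N then 1 else 0)"
proof (cases N)
  case (enat n)
  have "(\<Sum>i. if enat i < N then 1 else 0 :: ennreal) = (\<Sum>i<n. if enat i < N then 1 else 0)"
    by (rule suminf_finite) (auto simp: enat)
  then show ?thesis by (simp add: enat)
next
  case infinity
  have "(\<Sum>i. 1 :: ennreal) = top"
    by (simp add: suminf_eq_SUP ennreal_SUP_of_nat_eq_top)
  then show ?thesis by (simp add: infinity)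
qed

section \<open>One-step disintegration of the run measure\<close>

text \<open>As long as a run has not stopped, \<open>next_step\<close> depends on it only through
  its history. Isolating this dependence allows the two processes to be compared on histories
  instead of runs.\<close>

definition next_dist :: "('s, 'a) proc \<Rightarrow> ('s, 'a) strategy \<Rightarrow> 's \<Rightarrow> ('a \<times> 's) list \<Rightarrow> ('a \<times> 's) spmf" where
  "next_dist P f s h =
    (if is_path P s h \<and> available P (last_state (s, h)) \<noteq> {}
     then bind_pmf (f (s, h)) (\<lambda>a. map_spmf (Pair a) (ptrans P (last_state (s, h)) a))
     else return_pmf None)"

lemma next_step_eq_next_dist:
  "next_step P f s n \<omega> =
    (if \<forall>i<n. \<omega> i \<noteq> None then next_dist P f s (history \<omega> n) else return_pmf None)"
  by (auto simp: next_step_def next_dist_def Let_def)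

lemma history_Suc: "history \<omega> (Suc n) = history \<omega> n @ [the (\<omega> n)]"
  by (simp add: history_def)

lemma history_cong: "(\<And>i. i < n \<Longrightarrow> \<omega> i = \<omega>' i) \<Longrightarrow> history \<omega> n = history \<omega>' n"
  by (simp add: history_def)

lemma history_restrict: "history (restrict \<omega> {0..<n}) n = history \<omega> n"
  by (rule history_cong) simp

context
  fixes P :: "('s, 'a) proc" and f :: "('s, 'a) strategy"
  assumes wf: "proc_wf P" and strat: "f \<in> strategies P"
begin

text \<open>There are finitely many steps and finitely many coordinates, so the product
  sigma-algebra is discrete.\<close>

lemma measurable_PiM_steps:
  "G \<in> borel_measurable (PiM {0..<n::nat} (\<lambda>_. count_space (steps P)))"
proof -
  have "finite (steps P)"
    using wf by (auto simp: steps_def proc_wf_def)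
  then show ?thesis
    by (subst count_space_PiM_finite) (auto simp: countable_finite)
qed

lemma measurable_run_measure_finitely_determined:
  "(\<lambda>\<omega>. G (restrict \<omega> {0..<n})) \<in> borel_measurable (run_measure P f s)"
proof -
  interpret Ionescu_Tulcea "step_measure P f s" "\<lambda>_. count_space (steps P)"
    by (rule Ionescu_Tulcea_step_measure[OF wf strat])
  have "(\<lambda>\<omega>. restrict \<omega> {0..<n}) \<in> run_measure P f s \<rightarrow>\<^sub>M PiM {0..<n} (\<lambda>_. count_space (steps P))"
    unfolding run_measure_def measurable_cong_sets[OF PF.sets_lim refl]
    by (rule measurable_restrict) (simp add: measurable_component_singleton)
  from measurable_compose[OF this measurable_PiM_steps] show ?thesis .
qed

lemma nn_integral_step_measure:
  "(\<integral>\<^sup>+z. g z \<partial>step_measure P f s n \<omega>) = (\<integral>\<^sup>+z. g z \<partial>measure_pmf (next_step P f s n \<omega>))"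
  unfolding step_measure_def
  using set_next_step[OF wf strat]
  by (subst nn_integral_restrict_space)
    (auto simp: AE_measure_pmf_iff subset_eq intro!: nn_integral_cong_AE)

text \<open>The tower property at time \<open>n\<close>. The test that entry \<open>n\<close> is not
  \<open>None\<close> disappears on the right because \<open>measure_spmf\<close> already drops the
  mass of \<open>None\<close>.\<close>

lemma nn_integral_run_measure_step:
  "(\<integral>\<^sup>+\<omega>. (if \<forall>i<Suc n. \<omega> i \<noteq> None then g (history \<omega> n) (the (\<omega> n)) else 0) \<partial>run_measure P f s) =
   (\<integral>\<^sup>+\<omega>. (if \<forall>i<n. \<omega> i \<noteq> None
          then \<integral>\<^sup>+z. g (history \<omega> n) z \<partial>measure_spmf (next_dist P f s (history \<omega> n))
          else 0) \<partial>run_measure P f s)"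
proof -
  interpret Ionescu_Tulcea "step_measure P f s" "\<lambda>_. count_space (steps P)"
    by (rule Ionescu_Tulcea_step_measure[OF wf strat])
  let ?G = "\<lambda>\<omega>. if \<forall>i<Suc n. \<omega> i \<noteq> None then g (history \<omega> n) (the (\<omega> n)) else 0"
  have "?G \<omega> = ?G (restrict \<omega> {0..<Suc n})" for \<omega>
    using history_cong[of n \<omega> "restrict \<omega> {0..<Suc n}"] by auto
  then have "(\<integral>\<^sup>+\<omega>. ?G \<omega> \<partial>run_measure P f s) = (\<integral>\<^sup>+\<omega>. ?G (restrict \<omega> {0..<Suc n}) \<partial>PF.lim)"
    unfolding run_measure_def by (intro nn_integral_cong)
  also have "\<dots> = (\<integral>\<^sup>+\<omega>. (\<integral>\<^sup>+z. ?G ((restrict \<omega> {0..<n})(n := z))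
      \<partial>step_measure P f s n (restrict \<omega> {0..<n})) \<partial>PF.lim)"
    by (rule nn_integral_lim_Suc[OF measurable_PiM_steps])
  also have "\<dots> = (\<integral>\<^sup>+\<omega>. (if \<forall>i<n. \<omega> i \<noteq> None
          then \<integral>\<^sup>+z. g (history \<omega> n) z \<partial>measure_spmf (next_dist P f s (history \<omega> n))
          else 0) \<partial>PF.lim)"
  proof (rule nn_integral_cong)
    fix \<omega> :: "('s, 'a) run"
    have "history ((restrict \<omega> {0..<n})(n := z)) n = history \<omega> n" for z
      by (rule history_cong) simp
    then have "?G ((restrict \<omega> {0..<n})(n := z)) =
        (if \<forall>i<n. \<omega> i \<noteq> None then if z \<noteq> None then g (history \<omega> n) (the z) else 0 else 0)" for z
      by (auto simp: less_Suc_eq)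
    then show "(\<integral>\<^sup>+z. ?G ((restrict \<omega> {0..<n})(n := z)) \<partial>step_measure P f s n (restrict \<omega> {0..<n})) =
        (if \<forall>i<n. \<omega> i \<noteq> None
          then \<integral>\<^sup>+z. g (history \<omega> n) z \<partial>measure_spmf (next_dist P f s (history \<omega> n))
          else 0)"
      by (auto simp: nn_integral_step_measure next_step_eq_next_dist history_restrict
          nn_integral_measure_spmf_option)
  qed
  finally show ?thesis
    unfolding run_measure_def .
qed

end

text \<open>Runs that stop before time \<open>n\<close> contribute \<open>0\<close>.\<close>

definition expect_history ::
    "('s, 'a) proc \<Rightarrow> ('s, 'a) strategy \<Rightarrow> 's \<Rightarrow> nat \<Rightarrow> (('a \<times> 's) list \<Rightarrow> ennreal) \<Rightarrow> ennreal" where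
  "expect_history P f s n g =
    (\<integral>\<^sup>+\<omega>. (if \<forall>i<n. \<omega> i \<noteq> None then g (history \<omega> n) else 0) \<partial>run_measure P f s)"

lemma expect_history_0:
  assumes "proc_wf P" "f \<in> strategies P"
  shows "expect_history P f s 0 g = g []"
  using prob_space.emeasure_space_1[OF prob_space_run_measure[OF assms]]
  by (simp add: expect_history_def history_def)

lemma expect_history_Suc:
  assumes "proc_wf P" "f \<in> strategies P"
  shows "expect_history P f s (Suc n) g =
    expect_history P f s n (\<lambda>h. \<integral>\<^sup>+z. g (h @ [z]) \<partial>measure_spmf (next_dist P f s h))"
  unfolding expect_history_def history_Suc
  by (rule nn_integral_run_measure_step[OF assms])

lemma expect_history_cong:
  "(\<And>h. g h = g' h) \<Longrightarrow> expect_history P f s n g = expect_history P f s n g'"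
  by presburger

section \<open>Expected rewards as series over time\<close>

fun count_accepting :: "('s \<times> 'a \<times> 's) set \<Rightarrow> 's \<Rightarrow> ('a \<times> 's) list \<Rightarrow> nat" where
  "count_accepting F s [] = 0"
| "count_accepting F s ((a, y) # h) = (if (s, a, y) \<in> F then 1 else 0) + count_accepting F y h"

lemma count_accepting_snoc:
  "count_accepting F s (h @ [z]) = count_accepting F s h + (if (last_state (s, h), z) \<in> F then 1 else 0)"
  by (induction F s h rule: count_accepting.induct) (cases z; simp add: last_state.simps)+

lemma accepting_positions_iff:
  "i \<in> accepting_positions F s \<omega> \<longleftrightarrow>
    (\<forall>j<Suc i. \<omega> j \<noteq> None) \<and> (last_state (s, history \<omega> i), the (\<omega> i)) \<in> F"
  by (auto simp: accepting_positions_def transition_def run_state_def less_Suc_eq_le)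

text \<open>Serves to express the rank of an accepting position through the history alone.\<close>

lemma card_accepting_positions_below:
  assumes "\<forall>i<n. \<omega> i \<noteq> None"
  shows "card (accepting_positions F s \<omega> \<inter> {..<n}) = count_accepting F s (history \<omega> n)"
  using assms
proof (induction n)
  case 0
  then show ?case by (simp add: history_def)
next
  case (Suc n)
  then have "n \<in> accepting_positions F s \<omega> \<longleftrightarrow> (last_state (s, history \<omega> n), the (\<omega> n)) \<in> F"
    unfolding accepting_positions_iff by blast
  with Suc show ?case
    by (simp add: lessThan_Suc Int_insert_right history_Suc count_accepting_snoc)
qed

text \<open>Reindexing by time, exchanging sum and integral, and integrating out the last step. The
  weights \<open>c\<close> are general so that powers of \<zeta> give the biased reward and the
  constant \<open>1\<close> gives the total reward.\<close>

lemma nn_integral_suminf_accepting: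
  fixes c :: "nat \<Rightarrow> ennreal"
  assumes "proc_wf P" "f \<in> strategies P"
  shows "(\<integral>\<^sup>+\<omega>. (\<Sum>i. if enat i < n_accepting F s \<omega> then c i else 0) \<partial>run_measure P f s) =
    (\<Sum>i. expect_history P f s i (\<lambda>h.
      \<integral>\<^sup>+z. (if (last_state (s, h), z) \<in> F then c (count_accepting F s h) else 0)
        \<partial>measure_spmf (next_dist P f s h)))"
proof -
  let ?t = "\<lambda>i \<omega>. if \<forall>j<Suc i. \<omega> j \<noteq> None
    then if (last_state (s, history \<omega> i), the (\<omega> i)) \<in> F
      then c (count_accepting F s (history \<omega> i)) else 0 else 0"
  have "(\<Sum>i. if enat i < n_accepting F s \<omega> then c i else 0) = (\<Sum>i. ?t i \<omega>)" for \<omega>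
    unfolding n_accepting_def suminf_card_reindex
    by (intro suminf_cong) (auto simp: accepting_positions_iff card_accepting_positions_below simp del: not_None_eq)
  then have "(\<integral>\<^sup>+\<omega>. (\<Sum>i. if enat i < n_accepting F s \<omega> then c i else 0) \<partial>run_measure P f s) =
      (\<integral>\<^sup>+\<omega>. (\<Sum>i. ?t i \<omega>) \<partial>run_measure P f s)"
    by simp
  also have "\<dots> = (\<Sum>i. \<integral>\<^sup>+\<omega>. ?t i \<omega> \<partial>run_measure P f s)"
  proof (rule nn_integral_suminf)
    fix i
    \<comment> \<open>The term for time \<open>i\<close> reads only the first \<open>Suc i\<close>
      entries, which makes it measurable.\<close>
    have eq: "?t i = (\<lambda>\<omega>. ?t i (restrict \<omega> {0..<Suc i}))"
    proof
      fix \<omega> :: "('a, 'b) run"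
      show "?t i \<omega> = ?t i (restrict \<omega> {0..<Suc i})"
        using history_cong[of i \<omega> "restrict \<omega> {0..<Suc i}"] by auto
    qed
    show "?t i \<in> borel_measurable (run_measure P f s)"
      by (subst eq) (rule measurable_run_measure_finitely_determined[OF assms, of "?t i"])
  qed
  also have "\<dots> = (\<Sum>i. expect_history P f s i (\<lambda>h.
      \<integral>\<^sup>+z. (if (last_state (s, h), z) \<in> F then c (count_accepting F s h) else 0)
        \<partial>measure_spmf (next_dist P f s h)))"
    unfolding expect_history_def
    by (subst nn_integral_run_measure_step[OF assms, where g = "\<lambda>h z. if (last_state (s, h), z) \<in> F
      then c (count_accepting F s h) else 0"]) (rule refl)
  finally show ?thesis .
qed

section \<open>Comparison with the process extended by a sink\<close>

abbreviation lift_history :: "('b \<times> 'x) list \<Rightarrow> ('b \<times> 'x with_sink) list" where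
  "lift_history \<equiv> map (\<lambda>(b, y). (b, State y))"

lemma last_state_lift_history: "last_state (State x, lift_history h) = State (last_state (x, h))"
  by (auto simp: last_state.simps last_map split: prod.splits)

lemma is_path_lift_history:
  assumes "0 < \<zeta>" "\<zeta> < 1"
  shows "is_path (add_sink \<zeta> P F) (State x) (lift_history h) \<longleftrightarrow> is_path P x h"
proof (induction P x h rule: is_path.induct)
  case (2 P s a s' h)
  have "spmf (ptrans (add_sink \<zeta> P F) (State s) a) (State s') > 0 \<longleftrightarrow> spmf (ptrans P s a) s' > 0"
    using assms by (simp add: spmf_add_sink_State zero_less_mult_iff)
  with 2 show ?case
    by (auto simp: add_sink_def)
qed (auto simp: add_sink_def)

lemma lift_strategy_lift_history: "lift_strategy f (State x, lift_history h) = f (x, h)"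
  by (simp add: lift_strategy_def case_prod_beta comp_def)

text \<open>No transition leaves the sink, so a path that visits it must end there.\<close>

lemma is_path_no_sink:
  assumes "is_path (add_sink \<zeta> P F) u h" "last_state (u, h) \<noteq> Sink"
  shows "Sink \<notin> snd ` set h"
  using assms
proof (induction h arbitrary: u)
  case (Cons z h)
  obtain b y where z: "z = (b, y)" by (cases z)
  have last: "last_state (u, z # h) = last_state (y, h)"
    by (simp add: last_state.simps z)
  have "y \<noteq> Sink"
  proof
    assume y: "y = Sink"
    with Cons.prems(2) have "h \<noteq> []"
      by (auto simp: z last_state.simps)
    then obtain b' y' h' where "h = (b', y') # h'"
      by (cases h) auto
    with Cons.prems(1) show False
      by (simp add: z y spmf_add_sink_from_Sink)
  qed
  with Cons last show ?case
    by (auto simp: z)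
qed simp

text \<open>Either the history ends in the sink, where no action is available, or it continues after
  the sink and is not a path.\<close>

lemma next_dist_sink:
  assumes "Sink \<in> snd ` set h"
  shows "next_dist (add_sink \<zeta> P F) g u h = return_pmf None"
proof (cases "last_state (u, h)")
  case (State x)
  then show ?thesis
    using is_path_no_sink[of \<zeta> P F u h] assms by (auto simp: next_dist_def)
next
  case Sink
  then show ?thesis by (simp add: next_dist_def available_add_sink_Sink)
qed

lemma nn_integral_ptrans_add_sink:
  assumes "0 < \<zeta>" "\<zeta> < 1"
  shows "(\<integral>\<^sup>+u. k u \<partial>measure_spmf (ptrans (add_sink \<zeta> P F) (State x) b)) =
    (\<integral>\<^sup>+y. (if (x, b, y) \<in> F then ennreal \<zeta> * k (State y) + ennreal (1 - \<zeta>) * k Sink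
          else k (State y)) \<partial>measure_spmf (ptrans P x b))"
  unfolding ptrans_add_sink_State nn_integral_bind_spmf
  by (rule nn_integral_cong)
    (use assms in \<open>auto simp: nn_integral_measure_spmf_option nn_integral_bernoulli_pmf spmf_of_pmf_def mult.commute\<close>)

text \<open>On lifted histories, paths, available actions and choices agree with those of
  \<open>P\<close>; only the Bernoulli split of accepting transitions is added.\<close>

lemma nn_integral_next_dist_add_sink:
  assumes "0 < \<zeta>" "\<zeta> < 1"
  shows "(\<integral>\<^sup>+u. k u \<partial>measure_spmf (next_dist (add_sink \<zeta> P F) (lift_strategy f) (State x) (lift_history h))) =
    (\<integral>\<^sup>+z. (if (last_state (x, h), z) \<in> F
          then ennreal \<zeta> * k (fst z, State (snd z)) + ennreal (1 - \<zeta>) * k (fst z, Sink)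
          else k (fst z, State (snd z))) \<partial>measure_spmf (next_dist P f x h))"
  using assms
  by (auto simp: next_dist_def is_path_lift_history last_state_lift_history available_add_sink_State
      lift_strategy_lift_history nn_integral_measure_spmf_bind_pmf nn_integral_ptrans_add_sink
      comp_def cong: if_cong intro!: nn_integral_cong)

text \<open>A change of measure: each accepting transition passes on only the share \<zeta> of its
  mass to histories that avoid the sink. The induction needs arbitrary \<open>g\<close> because
  every step integrates the last transition into \<open>g\<close>.\<close>

lemma expect_history_add_sink:
  assumes "0 < \<zeta>" "\<zeta> < 1" "proc_wf P" "f \<in> strategies P"
  shows "expect_history (add_sink \<zeta> P F) (lift_strategy f) (State x) n
      (\<lambda>h. if Sink \<in> snd ` set h then 0 else g h) =
    expect_history P f x n (\<lambda>h. ennreal \<zeta> ^ count_accepting F x h * g (lift_history h))"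
proof (induction n arbitrary: g)
  case 0
  show ?case
    using assms by (simp add: expect_history_0 proc_wf_add_sink lift_strategy_in_strategies)
next
  case (Suc n)
  let ?P = "add_sink \<zeta> P F" and ?f = "lift_strategy f"
  let ?g = "\<lambda>h. \<integral>\<^sup>+z. (if snd z = Sink then 0 else g (h @ [z])) \<partial>measure_spmf (next_dist ?P ?f (State x) h)"
  have "expect_history ?P ?f (State x) (Suc n) (\<lambda>h. if Sink \<in> snd ` set h then 0 else g h) =
      expect_history ?P ?f (State x) n (\<lambda>h. if Sink \<in> snd ` set h then 0 else ?g h)"
    \<comment> \<open>\<open>h @ [z]\<close> avoids the sink iff \<open>h\<close> does and
      \<open>z\<close> does not lead to it.\<close>
    using assms
    by (subst expect_history_Suc)
      (auto simp: proc_wf_add_sink lift_strategy_in_strategies image_iff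
        intro!: expect_history_cong nn_integral_cong)
  also have "\<dots> = expect_history P f x n (\<lambda>h. ennreal \<zeta> ^ count_accepting F x h * ?g (lift_history h))"
    by (rule Suc.IH)
  \<comment> \<open>The outcome in the sink contributes \<open>0\<close>; the remaining factor
    \<zeta> raises the exponent exactly when \<open>z\<close> is accepting.\<close>
  also have "\<dots> = expect_history P f x n (\<lambda>h. \<integral>\<^sup>+z. ennreal \<zeta> ^ count_accepting F x (h @ [z]) *
      g (lift_history (h @ [z])) \<partial>measure_spmf (next_dist P f x h))"
    by (rule expect_history_cong)
      (auto simp: nn_integral_next_dist_add_sink[OF assms(1,2)] count_accepting_snoc mult_ac
        nn_integral_cmult[symmetric] case_prod_beta intro!: nn_integral_cong)
  also have "\<dots> = expect_history P f x (Suc n)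
      (\<lambda>h. ennreal \<zeta> ^ count_accepting F x h * g (lift_history h))"
    by (rule expect_history_Suc[symmetric, OF assms(3,4)])
  finally show ?case .
qed

lemma expected_discount_eq_expected_total:
  assumes "0 < \<zeta>" "\<zeta> < 1" "proc_wf P" "f \<in> strategies P"
  shows "(\<integral>\<^sup>+\<omega>. Disct \<zeta> (n_accepting F x \<omega>) \<partial>run_measure P f x) =
    (\<integral>\<^sup>+\<omega>. ennreal_of_enat (n_accepting (sink_acc F) (State x) \<omega>)
      \<partial>run_measure (add_sink \<zeta> P F) (lift_strategy f) (State x))"
proof -
  let ?P = "add_sink \<zeta> P F" and ?f = "lift_strategy f"
  let ?g = "\<lambda>h. \<integral>\<^sup>+z. (if (last_state (State x, h), z) \<in> sink_acc F then 1 else 0)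
        \<partial>measure_spmf (next_dist ?P ?f (State x) h)"
  have g: "ennreal \<zeta> ^ count_accepting F x h * ?g (lift_history h) =
      (\<integral>\<^sup>+z. (if (last_state (x, h), z) \<in> F then ennreal (\<zeta> ^ count_accepting F x h) else 0)
        \<partial>measure_spmf (next_dist P f x h))" for h
  proof -
    \<comment> \<open>Both outcomes of an accepting transition lie in \<open>sink_acc F\<close>, so
      their weights add up to \<open>1\<close> and the transition counts fully.\<close>
    have "ennreal \<zeta> + ennreal (1 - \<zeta>) = 1"
      using assms by (simp flip: ennreal_plus)
    then have "?g (lift_history h) = (\<integral>\<^sup>+z. (if (last_state (x, h), z) \<in> F then 1 else 0)
        \<partial>measure_spmf (next_dist P f x h))"
      by (auto simp: nn_integral_next_dist_add_sink[OF assms(1,2)] last_state_lift_history sink_acc_def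
          intro!: nn_integral_cong)
    then show ?thesis
      using assms by (auto simp: nn_integral_cmult[symmetric] ennreal_power intro!: nn_integral_cong)
  qed
  have "(\<integral>\<^sup>+\<omega>. Disct \<zeta> (n_accepting F x \<omega>) \<partial>run_measure P f x) =
      (\<Sum>i. expect_history P f x i (\<lambda>h. ennreal \<zeta> ^ count_accepting F x h * ?g (lift_history h)))"
    unfolding Disct_def g by (rule nn_integral_suminf_accepting[OF assms(3,4)])
  also have "\<dots> = (\<Sum>i. expect_history ?P ?f (State x) i (\<lambda>h. if Sink \<in> snd ` set h then 0 else ?g h))"
    by (simp only: expect_history_add_sink[OF assms])
  also have "\<dots> = (\<Sum>i. expect_history ?P ?f (State x) i ?g)"
    by (intro suminf_cong expect_history_cong) (auto simp: next_dist_sink)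
  also have "\<dots> = (\<integral>\<^sup>+\<omega>. ennreal_of_enat (n_accepting (sink_acc F) (State x) \<omega>)
      \<partial>run_measure ?P ?f (State x))"
    unfolding ennreal_of_enat_eq_suminf
    using assms by (subst nn_integral_suminf_accepting)
      (simp_all add: proc_wf_add_sink lift_strategy_in_strategies)
  finally show ?thesis .
qed

theorem theorem3:
  fixes M :: "('s, 'a, 'l) mdp" and A :: "('l, 'q) buchi" and \<zeta> :: real
    and f :: "('s \<times> 'q, 'a \<times> 'q) strategy" and s :: 's and q :: 'q
  assumes "is_mdp M" and "is_buchi A" and "malphabet M = alphabet A"
    and "good_for_mdps A"
    and "0 < \<zeta>" and "\<zeta> < 1"
    and "f \<in> strategies (product M A)"
    and "(s, q) \<in> pstates (product M A)"
  shows "EDisct M A \<zeta> (s, q) f = ETotal M A \<zeta> (s, q) f"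
  unfolding EDisct_def ETotal_def
  using assms by (intro expected_discount_eq_expected_total proc_wf_product)

end
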